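(* Let $N,D\ge 1$ be integers and let $\nabla F$ be a shape gradient, i.e. a rule which assigns to every Jordan parametrization $\alpha\in\mathcal{C}^0_J([0,1],E)$ and every point $M\in\alpha([0,1])$ a vector $\nabla F(\alpha)(M)\in T_M E$. Then the map $B_{N,D}^{-1}\circ\mathcal{T}_{N,F}$ defines a vector field on $H_{N,D}$ (at the control polygons of curves in $\mathcal{B}^c_{N,D}$), which corresponds through $T\Psi^c_{N,D}$ to a vector field $V_F$ on $\mathcal{B}^c_{N,D}$. Explicitly: for every $\alpha\in\mathcal{B}^c_{N,D}$, with control polygon $\mathbf{P}=B_{N,D}^{-1}(\mathcal{S}_N(\alpha))\in H_{N,D}$, one has $B_{N,D}^{-1}\big(\mathcal{T}_{N,F}(\alpha)\big)\in T_{\mathbf{P}}H_{N,D}$, and $V_F(\alpha):=T_{\mathbf{P}}\Psi^c_{N,D}\big(B_{N,D}^{-1}(\mathcal{T}_{N,F}(\alpha))\big)\in T_\alpha\mathcal{B}^c_{N,D}$.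
   Context: $E=\mathbb{R}^2$. $\mathcal{C}^0_J([0,1],E)$ is the set of continuous maps $[0,1]\to E$ parametrizing a Jordan curve (closed, and injective except that the values at $0$ and $1$ agree). Bézier curves: for $P_0,\dots,P_D\in E$, $B((P_0,\dots,P_D),t)=\sum_{i=0}^D P_i\,b_{i,D}(t)$ with $b_{i,D}(t)=\binom{D}{i}(1-t)^{D-i}t^i$. Control polygons with $N$ patches of degree $D$: $K_{N,D}$ is the linear space of $\mathbf{P}=(P_{i,j})_{0\le i\le N-1,\,0\le j\le D}\in(E^{D+1})^N$ with $P_{i,D}=P_{i+1,0}$ for $0\le i\le N-2$. The map $\Psi_{N,D}:K_{N,D}\to\mathcal{C}^0([0,1],E)$ is given by $\Psi_{N,D}(\mathbf{P})(t)=B((P_{i,0},\dots,P_{i,D}),Nt-i)$ for $t\in[\frac iN,\frac{i+1}N]$. Its image is $\mathcal{B}_{N,D}$, the space of uniform piecewise Bézier curves. $\mathcal{B}^c_{N,D}$ is the set of $\gamma\in\mathcal{B}_{N,D}$ such that for $s\ne t$ in $[0,1]$, $\gamma(s)=\gamma(t)$ if and only if $\{s,t\}=\{0,1\}$. $H_{N,D}=\{\mathbf{P}\in K_{N,D}: P_{0,0}=P_{N-1,D}\}$, and $\Psi^c_{N,D}=\Psi_{N,D}|_{H_{N,D}}$. Since $H_{N,D}$ is a vector space, $T_{\mathbf{P}}H_{N,D}=H_{N,D}$; since $\Psi^c_{N,D}$ is linear, $T_{\mathbf{P}}\Psi^c_{N,D}=\Psi^c_{N,D}$; and $T_\alpha\mathcal{B}^c_{N,D}$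 is understood as the linear space $\Psi^c_{N,D}(H_{N,D})$ of closed piecewise Bézier deformation curves. Regular sampling: $\mathcal{S}_N(\Gamma)=(\Gamma(t_{i,j}))_{0\le i\le N-1,\,0\le j\le D}\in(E^{D+1})^N$, with $t_{i,j}=\frac iN+\frac{j}{ND}$. $B_{N,D}$ (roman) is the linear automorphism of $(E^{D+1})^N$ acting on each of the $N$ blocks by the invertible matrix $(b_{k,D}(j/D))_{0\le j,k\le D}$, i.e. $(B_{N,D}\mathbf{P})_{i,j}=\sum_{k=0}^D b_{k,D}(j/D)P_{i,k}$. For $\alpha\in\mathcal{B}^c_{N,D}$ with $\mathcal{S}_N(\alpha)=(M_{i,j})$, $\mathcal{T}_{N,F}(\alpha)=\big(\nabla F(\alpha)(M_{i,j})\big)_{0\le i\le N-1,\,0\le j\le D}\in(E^{D+1})^N$ (all tangent spaces $T_ME$ being identified with $E$). *)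

theory Defs
  imports "HOL-Analysis.Analysis" "HOL-Computational_Algebra.Polynomial"
begin

unbundle no fps_syntax

type_synonym plane = "real^2"
type_synonym curve = "real \<Rightarrow> plane"
type_synonym polygon = "nat \<Rightarrow> nat \<Rightarrow> plane"

(* Maps defined on [0,1], and families indexed by i < N and j \<le> D, are total functions that
   vanish outside their domain. Equality of representatives is then equality of the objects, and
   the vector space operations are the pointwise ones. *)

definition C0 :: "curve set" where
  "C0 = {\<gamma>. continuous_on {0..1} \<gamma> \<and> (\<forall>t. t \<notin> {0..1} \<longrightarrow> \<gamma> t = 0)}"

definition C0_J :: "curve set" where
  "C0_J = {\<gamma> \<in> C0. simple_path \<gamma> \<and> pathfinish \<gamma> = pathstart \<gamma>}"

definition tangent_plane :: "plane \<Rightarrow> plane set" where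
  "tangent_plane M = UNIV"

definition shape_gradients :: "(curve \<Rightarrow> plane \<Rightarrow> plane) set" where
  "shape_gradients = (\<Pi>\<^sub>E \<alpha>\<in>C0_J. \<Pi>\<^sub>E M\<in>\<alpha> ` {0..1}. tangent_plane M)"

definition bezier :: "nat \<Rightarrow> (nat \<Rightarrow> plane) \<Rightarrow> real \<Rightarrow> plane" where
  "bezier D P t = (\<Sum>i\<le>D. Bernstein D i t *\<^sub>R P i)"

definition arrays :: "nat \<Rightarrow> nat \<Rightarrow> polygon set" where
  "arrays N D = {P. \<forall>i j. \<not> (i < N \<and> j \<le> D) \<longrightarrow> P i j = 0}"

definition K :: "nat \<Rightarrow> nat \<Rightarrow> polygon set" where
  "K N D = {P \<in> arrays N D. \<forall>i. i + 1 < N \<longrightarrow> P i D = P (i + 1) 0}"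

definition H :: "nat \<Rightarrow> nat \<Rightarrow> polygon set" where
  "H N D = {P \<in> K N D. P 0 0 = P (N - 1) D}"

(* The patch chosen at a junction t = i/N is immaterial on K N D: see Psi_patch. *)
definition Psi :: "nat \<Rightarrow> nat \<Rightarrow> polygon \<Rightarrow> curve" where
  "Psi N D P t =
     (if t \<in> {0..1}
      then let i = min (nat \<lfloor>real N * t\<rfloor>) (N - 1) in bezier D (P i) (real N * t - real i)
      else 0)"

definition Psi_c :: "nat \<Rightarrow> nat \<Rightarrow> polygon \<Rightarrow> curve" where
  "Psi_c N D = restrict (Psi N D) (H N D)"

definition piecewise_bezier :: "nat \<Rightarrow> nat \<Rightarrow> curve set" where
  "piecewise_bezier N D = Psi N D ` K N D"

definition piecewise_bezier_c :: "nat \<Rightarrow> nat \<Rightarrow> curve set" where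
  "piecewise_bezier_c N D = {\<gamma> \<in> piecewise_bezier N D.
     \<forall>s\<in>{0..1}. \<forall>t\<in>{0..1}. s \<noteq> t \<longrightarrow> (\<gamma> s = \<gamma> t \<longleftrightarrow> {s, t} = {0, 1})}"

definition sampling :: "nat \<Rightarrow> nat \<Rightarrow> curve \<Rightarrow> polygon" where
  "sampling N D \<gamma> = (\<lambda>i j. if i < N \<and> j \<le> D
     then \<gamma> (real i / real N + real j / (real N * real D)) else 0)"

definition block_map :: "nat \<Rightarrow> nat \<Rightarrow> polygon \<Rightarrow> polygon" where
  "block_map N D P = (\<lambda>i j. if i < N \<and> j \<le> D
     then (\<Sum>k\<le>D. Bernstein D k (real j / real D) *\<^sub>R P i k) else 0)"

(* A two-sided inverse on arrays N D when D \<ge> 1: see block_map_bij. *)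
definition block_map_inv :: "nat \<Rightarrow> nat \<Rightarrow> polygon \<Rightarrow> polygon" where
  "block_map_inv N D = inv_into (arrays N D) (block_map N D)"

definition gradient_sampling ::
  "nat \<Rightarrow> nat \<Rightarrow> (curve \<Rightarrow> plane \<Rightarrow> plane) \<Rightarrow> curve \<Rightarrow> polygon" where
  "gradient_sampling N D gradF \<alpha> = (\<lambda>i j. if i < N \<and> j \<le> D
     then gradF \<alpha> (sampling N D \<alpha> i j) else 0)"

(* H N D is a vector space and Psi_c is linear on it (H_subspace, Psi_linear): every tangent space
   of H N D is H N D, and the tangent map of Psi_c at any P is Psi_c. *)
definition tangent_H :: "nat \<Rightarrow> nat \<Rightarrow> polygon \<Rightarrow> polygon set" where
  "tangent_H N D P = H N D"

definition tangent_Psi_c :: "nat \<Rightarrow> nat \<Rightarrow> polygon \<Rightarrow> polygon \<Rightarrow> curve" where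
  "tangent_Psi_c N D P = Psi_c N D"

definition tangent_bezier_c :: "nat \<Rightarrow> nat \<Rightarrow> curve \<Rightarrow> curve set" where
  "tangent_bezier_c N D \<alpha> = Psi_c N D ` H N D"

definition vector_field_on :: "'p set \<Rightarrow> ('p \<Rightarrow> 'v set) \<Rightarrow> ('p \<Rightarrow> 'v) \<Rightarrow> bool" where
  "vector_field_on A T X \<longleftrightarrow> (\<forall>p\<in>A. X p \<in> T p)"

definition jordan_polygons :: "nat \<Rightarrow> nat \<Rightarrow> polygon set" where
  "jordan_polygons N D = {P \<in> H N D. Psi_c N D P \<in> piecewise_bezier_c N D}"

definition polygon_field ::
  "nat \<Rightarrow> nat \<Rightarrow> (curve \<Rightarrow> plane \<Rightarrow> plane) \<Rightarrow> polygon \<Rightarrow> polygon" where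
  "polygon_field N D gradF P = block_map_inv N D (gradient_sampling N D gradF (Psi_c N D P))"

definition curve_field ::
  "nat \<Rightarrow> nat \<Rightarrow> (curve \<Rightarrow> plane \<Rightarrow> plane) \<Rightarrow> curve \<Rightarrow> curve" where
  "curve_field N D gradF \<alpha> =
     tangent_Psi_c N D (block_map_inv N D (sampling N D \<alpha>))
       (block_map_inv N D (gradient_sampling N D gradF \<alpha>))"


lemma H_subspace:
  "(\<lambda>i j. 0) \<in> H N D"
  "P \<in> H N D \<Longrightarrow> Q \<in> H N D \<Longrightarrow> (\<lambda>i j. a *\<^sub>R P i j + b *\<^sub>R Q i j) \<in> H N D"
  by (auto simp: H_def K_def arrays_def)

lemma bezier_linear:
  "bezier D (\<lambda>j. a *\<^sub>R P j + b *\<^sub>R Q j) t = a *\<^sub>R bezier D P t + b *\<^sub>R bezier D Q t"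
  by (simp add: bezier_def scaleR_sum_right scaleR_add_right sum.distrib mult.commute)

lemma Psi_linear:
  "Psi N D (\<lambda>i j. a *\<^sub>R P i j + b *\<^sub>R Q i j) = (\<lambda>t. a *\<^sub>R Psi N D P t + b *\<^sub>R Psi N D Q t)"
  by (rule ext) (simp add: Psi_def Let_def bezier_linear)

lemma bezier_0: "bezier D P 0 = P 0"
proof -
  have "bezier D P 0 = (\<Sum>i\<le>D. if i = 0 then P 0 else 0)"
    unfolding bezier_def by (rule sum.cong) (auto simp: Bernstein_def power_0_left)
  then show ?thesis by simp
qed

lemma bezier_1: "bezier D P 1 = P D"
proof -
  have "bezier D P 1 = (\<Sum>i\<le>D. if i = D then P D else 0)"
    unfolding bezier_def by (rule sum.cong) (auto simp: Bernstein_def power_0_left)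
  then show ?thesis by simp
qed

lemma Psi_patch:
  assumes P: "P \<in> K N D" and i: "i < N"
    and t: "t \<in> {real i / real N .. (real i + 1) / real N}"
  shows "Psi N D P t = bezier D (P i) (real N * t - real i)"
proof -
  have N: "real N > 0" using i by simp
  have lo: "real i \<le> real N * t" and hi: "real N * t \<le> real i + 1"
    using t N by (auto simp: field_simps)
  have "real i + 1 \<le> real N" using i by linarith
  then have "real N * t \<le> real N * 1" and "real N * 0 \<le> real N * t" using lo hi by linarith+
  then have t01: "t \<in> {0..1}" using N by (simp only: mult_le_cancel_left_pos atLeastAtMost_iff)
  show ?thesis
  proof (cases "real N * t = real i + 1 \<and> i + 1 < N")
    case True
    then have "nat \<lfloor>real N * t\<rfloor> = i + 1" by (simp add: nat_add_distrib)
    then have "min (nat \<lfloor>real N * t\<rfloor>) (N - 1) = i + 1" using True by linarith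
    then have "Psi N D P t = bezier D (P (i + 1)) 0"
      unfolding Psi_def Let_def using t01 True by simp
    moreover have "P i D = P (i + 1) 0" using P True by (simp add: K_def)
    ultimately show ?thesis using True by (simp add: bezier_0 bezier_1)
  next
    case False
    have "min (nat \<lfloor>real N * t\<rfloor>) (N - 1) = i"
    proof (cases "real N * t < real i + 1")
      case True
      then have "\<lfloor>real N * t\<rfloor> = int i" using lo by (simp add: floor_eq_iff)
      then show ?thesis using i by simp
    next
      case F: False
      then have "real N * t = real i + 1" "i + 1 = N" using hi False i by auto
      then have "nat \<lfloor>real N * t\<rfloor> = i + 1" by (simp add: nat_add_distrib)
      then show ?thesis using \<open>i + 1 = N\<close> by linarith
    qed
    then show ?thesis unfolding Psi_def Let_def using t01 by simp
  qed
qed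

lemma Psi_in_C0:
  assumes "N \<ge> 1" "P \<in> K N D"
  shows "Psi N D P \<in> C0"
proof -
  let ?I = "\<lambda>i. {real i / real N .. (real i + 1) / real N}"
  have "continuous_on (\<Union>i\<in>{..<N}. ?I i) (Psi N D P)"
  proof (rule continuous_on_closed_Union)
    fix i assume "i \<in> {..<N}"
    then have i: "i < N" by simp
    have "continuous_on (?I i) (\<lambda>t. bezier D (P i) (real N * t - real i))"
      unfolding bezier_def Bernstein_def by (intro continuous_intros)
    moreover have "continuous_on (?I i) (Psi N D P)
        \<longleftrightarrow> continuous_on (?I i) (\<lambda>t. bezier D (P i) (real N * t - real i))"
      by (intro continuous_on_cong refl Psi_patch[OF assms(2) i])
    ultimately show "continuous_on (?I i) (Psi N D P)" by simp
  qed auto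
  moreover have "{0..1} \<subseteq> (\<Union>i\<in>{..<N}. ?I i)"
  proof
    fix t :: real assume t: "t \<in> {0..1}"
    have N: "real N > 0" using assms by simp
    show "t \<in> (\<Union>i\<in>{..<N}. ?I i)"
    proof (cases "t = 1")
      case True
      have "t \<in> ?I (N - 1)" using True N assms by (auto simp: field_simps of_nat_diff)
      then show ?thesis using assms by (intro UN_I[of "N - 1"]) auto
    next
      case False
      let ?i = "nat \<lfloor>real N * t\<rfloor>"
      have *: "0 \<le> real N * t" "real N * t < real N" using t False N by auto
      then have "?i < N" by linarith
      moreover have "real ?i \<le> real N * t" "real N * t \<le> real ?i + 1" using * by linarith+
      then have "t \<in> ?I ?i" using N by (auto simp: field_simps)
      ultimately show ?thesis by blast
    qed
  qed
  ultimately have "continuous_on {0..1} (Psi N D P)" by (rule continuous_on_subset)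
  then show ?thesis by (simp add: C0_def Psi_def)
qed

lemma piecewise_bezier_c_Jordan:
  assumes "N \<ge> 1"
  shows "piecewise_bezier_c N D \<subseteq> C0_J"
proof
  fix \<gamma> assume g: "\<gamma> \<in> piecewise_bezier_c N D"
  then have C: "\<gamma> \<in> C0"
    using Psi_in_C0[OF assms] by (auto simp: piecewise_bezier_c_def piecewise_bezier_def)
  have iff: "\<gamma> s = \<gamma> t \<longleftrightarrow> {s, t} = {0, 1}" if "s \<in> {0..1}" "t \<in> {0..1}" "s \<noteq> t" for s t
    using g that by (simp add: piecewise_bezier_c_def)
  have "\<gamma> 0 = \<gamma> 1" using iff[of 0 1] by simp
  moreover have "loop_free \<gamma>"
    unfolding loop_free_def
  proof (intro ballI impI)
    fix s t :: real assume "s \<in> {0..1}" "t \<in> {0..1}" "\<gamma> s = \<gamma> t"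
    then have "s = t \<or> {s, t} = {0, 1}" using iff by blast
    then show "s = t \<or> s = 0 \<and> t = 1 \<or> s = 1 \<and> t = 0" by (simp add: doubleton_eq_iff)
  qed
  ultimately show "\<gamma> \<in> C0_J"
    using C by (simp add: C0_J_def simple_path_def path_def C0_def pathfinish_def pathstart_def)
qed


lemma bernstein_eq_0:
  fixes c :: "nat \<Rightarrow> real"
  assumes D: "D \<ge> 1" and z: "\<And>j. j \<le> D \<Longrightarrow> (\<Sum>k\<le>D. Bernstein D k (real j / real D) * c k) = 0"
    and k: "k \<le> D"
  shows "c k = 0"
proof -
  define p where "p = (\<Sum>k\<le>D. smult (real (D choose k) * c k) ([:0,1:]^k * [:1,-1:]^(D-k)))"
  have pp: "poly p x = (\<Sum>k\<le>D. Bernstein D k x * c k)" for x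
    unfolding p_def Bernstein_def by (auto simp: poly_sum poly_power intro!: sum.cong)
  have "degree p \<le> D" unfolding p_def
  proof (rule degree_sum_le, simp)
    fix k assume "k \<in> {..D}"
    then show "degree (smult (real (D choose k) * c k) ([:0,1:]^k * [:1,-1:]^(D-k))) \<le> D"
      by (intro order.trans[OF degree_smult_le] order.trans[OF degree_mult_le])
         (auto simp: degree_power_eq degree_linear_power)
  qed
  have "p = 0"
  proof (rule ccontr)
    assume "p \<noteq> 0"
    let ?R = "(\<lambda>j. real j / real D) ` {..D}"
    have "inj_on (\<lambda>j. real j / real D) {..D}" using D by (auto simp: inj_on_def)
    then have "card ?R = Suc D" by (simp add: card_image)
    moreover have "?R \<subseteq> {x. poly p x = 0}" using z by (auto simp: pp)
    then have "card ?R \<le> card {x. poly p x = 0}"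
      using \<open>p \<noteq> 0\<close> by (intro card_mono poly_roots_finite)
    ultimately show False
      using card_poly_roots_bound[OF \<open>p \<noteq> 0\<close>] \<open>degree p \<le> D\<close> by linarith
  qed
  define q where "q = (\<Sum>k\<le>D. monom (real (D choose k) * c k) k)"
  have "poly q y = 0" if "y \<ge> 0" for y
  proof -
    have y: "1 + y \<noteq> 0" using that by simp
    have "Bernstein D k (y / (1 + y)) * c k * (1 + y)^D = real (D choose k) * c k * y^k"
      if "k \<le> D" for k
    proof -
      have "1 - y / (1 + y) = 1 / (1 + y)" using y by (simp add: field_simps)
      moreover have "(1 + y)^D = (1 + y)^k * (1 + y)^(D-k)"
        using that by (simp flip: power_add)
      ultimately show ?thesis
        using y by (simp add: Bernstein_def power_divide)
    qed
    then have "(\<Sum>k\<le>D. Bernstein D k (y / (1 + y)) * c k * (1 + y)^D)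
        = (\<Sum>k\<le>D. real (D choose k) * c k * y^k)"
      by (intro sum.cong[OF refl]) (simp only: atMost_iff)
    then have "poly q y = poly p (y / (1 + y)) * (1 + y)^D"
      unfolding q_def pp poly_sum poly_monom sum_distrib_right by (rule sym)
    then show ?thesis using \<open>p = 0\<close> by simp
  qed
  then have "{0..} \<subseteq> {y. poly q y = 0}" by auto
  then have "q = 0"
    using poly_roots_finite[of q] infinite_Ici[of "0::real"] finite_subset by blast
  then have "coeff q k = 0" by simp
  moreover have "coeff q k = real (D choose k) * c k"
    using k by (simp add: q_def coeff_sum)
  ultimately show ?thesis using k by simp
qed

lemma monomial_bernstein:
  assumes "m \<le> D"
  shows "\<exists>c. \<forall>x. x ^ m = (\<Sum>k\<le>D. Bernstein D k x * c k)"
proof -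
  define c where "c k = (if m \<le> k then real ((D - m) choose (k - m)) / real (D choose k) else 0)" for k
  have "x ^ m = (\<Sum>k\<le>D. Bernstein D k x * c k)" for x
  proof -
    have "x ^ m = x ^ m * (x + (1 - x)) ^ (D - m)" by simp
    also have "\<dots> = (\<Sum>i\<le>D-m. real ((D-m) choose i) * x^(i+m) * (1-x)^(D-m-i))"
      unfolding binomial_ring by (simp add: sum_distrib_left power_add mult_ac)
    also have "\<dots> = (\<Sum>k\<in>{m..D}. Bernstein D k x * c k)"
      by (rule sum.reindex_bij_witness[of _ "\<lambda>k. k - m" "\<lambda>i. i + m"])
         (use assms in \<open>auto simp: Bernstein_def c_def add.commute\<close>)
    also have "\<dots> = (\<Sum>k\<le>D. Bernstein D k x * c k)"
      by (rule sum.mono_neutral_left) (auto simp: c_def)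
    finally show ?thesis .
  qed
  then show ?thesis by blast
qed

lemma interpolation:
  fixes x v :: "nat \<Rightarrow> real"
  assumes "inj_on x {..n}"
  shows "\<exists>p. degree p \<le> n \<and> (\<forall>j\<le>n. poly p (x j) = v j)"
  using assms
proof (induction n)
  case 0
  show ?case by (rule exI[of _ "[:v 0:]"]) simp
next
  case (Suc n)
  then obtain p where p: "degree p \<le> n" "\<And>j. j \<le> n \<Longrightarrow> poly p (x j) = v j"
    by (force intro: inj_on_subset)
  define w where "w = (\<Prod>j\<le>n. [:- x j, 1:])"
  have w0: "poly w (x j) = 0" if "j \<le> n" for j using that by (auto simp: w_def poly_prod)
  have "x (Suc n) \<noteq> x j" if "j \<le> n" for j
    using Suc.prems that by (auto dest: inj_onD)
  then have wn: "poly w (x (Suc n)) \<noteq> 0" by (auto simp: w_def poly_prod)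
  have "degree w \<le> Suc n" unfolding w_def
    using degree_prod_sum_le[of "{..n}" "\<lambda>j. [:- x j, 1:]"] by simp
  let ?p = "p + smult ((v (Suc n) - poly p (x (Suc n))) / poly w (x (Suc n))) w"
  have "degree ?p \<le> Suc n"
    using p \<open>degree w \<le> Suc n\<close> by (intro degree_add_le order.trans[OF degree_smult_le]) auto
  moreover have "poly ?p (x j) = v j" if "j \<le> Suc n" for j
    using that p w0 wn by (cases "j = Suc n") auto
  ultimately show ?case by blast
qed

lemma bernstein_interpolation:
  fixes v :: "nat \<Rightarrow> real"
  assumes "D \<ge> 1"
  shows "\<exists>c. \<forall>j\<le>D. (\<Sum>k\<le>D. Bernstein D k (real j / real D) * c k) = v j"
proof -
  have "inj_on (\<lambda>j. real j / real D) {..D}" using assms by (auto simp: inj_on_def)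
  from interpolation[OF this, of v] obtain p
    where p: "degree p \<le> D" "\<And>j. j \<le> D \<Longrightarrow> poly p (real j / real D) = v j" by blast
  define c where "c = (\<lambda>m. SOME c. \<forall>x. x ^ m = (\<Sum>k\<le>D. Bernstein D k x * c k))"
  have c: "x ^ m = (\<Sum>k\<le>D. Bernstein D k x * c m k)" if "m \<le> D" for m x
    using someI_ex[OF monomial_bernstein[OF that]] unfolding c_def by blast
  have "poly p x = (\<Sum>k\<le>D. Bernstein D k x * (\<Sum>m\<le>degree p. coeff p m * c m k))" for x
  proof -
    have "poly p x = (\<Sum>m\<le>degree p. \<Sum>k\<le>D. coeff p m * (Bernstein D k x * c m k))"
      unfolding poly_altdef using p(1) by (simp add: c sum_distrib_left)
    also have "\<dots> = (\<Sum>k\<le>D. \<Sum>m\<le>degree p. coeff p m * (Bernstein D k x * c m k))"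
      by (rule sum.swap)
    finally show ?thesis by (simp add: sum_distrib_left mult_ac)
  qed
  then show ?thesis
    using p(2) by (intro exI[of _ "\<lambda>k. \<Sum>m\<le>degree p. coeff p m * c m k"]) simp
qed

lemma block_map_bij:
  assumes D: "D \<ge> 1"
  shows "bij_betw (block_map N D) (arrays N D) (arrays N D)"
  unfolding bij_betw_def
proof
  show "inj_on (block_map N D) (arrays N D)"
  proof (rule inj_onI)
    fix P Q assume P: "P \<in> arrays N D" and Q: "Q \<in> arrays N D"
      and eq: "block_map N D P = block_map N D Q"
    have "P i k = Q i k" for i k
    proof (cases "i < N \<and> k \<le> D")
      case False
      then have "P i k = 0" "Q i k = 0" using P Q unfolding arrays_def by blast+
      then show ?thesis by simp
    next
      case True
      show ?thesis
      proof (rule vec_eq_iff[THEN iffD2], rule allI)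
        fix e
        have "(P i k - Q i k) $ e = 0"
        proof (rule bernstein_eq_0[OF D, where c = "\<lambda>k. (P i k - Q i k) $ e"])
          fix j assume "j \<le> D"
          then have "(\<Sum>k\<le>D. Bernstein D k (real j / real D) *\<^sub>R P i k) $ e
              = (\<Sum>k\<le>D. Bernstein D k (real j / real D) *\<^sub>R Q i k) $ e"
            using fun_cong[OF fun_cong[OF eq, of i], of j] True by (simp add: block_map_def)
          then show "(\<Sum>k\<le>D. Bernstein D k (real j / real D) * (P i k - Q i k) $ e) = 0"
            by (simp add: right_diff_distrib sum_subtractf)
        qed (use True in simp)
        then show "P i k $ e = Q i k $ e" by simp
      qed
    qed
    then show "P = Q" by blast
  qed
next
  show "block_map N D ` arrays N D = arrays N D"
  proof
    show "block_map N D ` arrays N D \<subseteq> arrays N D"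
      by (auto simp: block_map_def arrays_def)
    show "arrays N D \<subseteq> block_map N D ` arrays N D"
    proof
      fix Q assume Q: "Q \<in> arrays N D"
      define c where "c = (\<lambda>i e. SOME c. \<forall>j\<le>D.
          (\<Sum>k\<le>D. Bernstein D k (real j / real D) * c k) = Q i j $ e)"
      have c: "(\<Sum>k\<le>D. Bernstein D k (real j / real D) * c i e k) = Q i j $ e"
        if "j \<le> D" for i e j
        using someI_ex[OF bernstein_interpolation[OF D, of "\<lambda>j. Q i j $ e"]] that
        unfolding c_def by blast
      define P where "P = (\<lambda>i k. if i < N \<and> k \<le> D then (\<chi> e. c i e k) else 0)"
      have "block_map N D P i j = Q i j" for i j
      proof (cases "i < N \<and> j \<le> D")
        case True
        then have "block_map N D P i j
            = (\<Sum>k\<le>D. Bernstein D k (real j / real D) *\<^sub>R (\<chi> e. c i e k))"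
          by (simp add: block_map_def P_def)
        also have "\<dots> = Q i j" using True by (simp add: vec_eq_iff c)
        finally show ?thesis .
      next
        case False
        then have "Q i j = 0" using Q unfolding arrays_def by blast
        then show ?thesis unfolding block_map_def using False by (simp only: if_False)
      qed
      then have "Q = block_map N D P" by (intro ext) simp
      moreover have "P \<in> arrays N D" by (auto simp: P_def arrays_def)
      ultimately show "Q \<in> block_map N D ` arrays N D" by blast
    qed
  qed
qed

end

theory Submission
  imports Defs
begin

text \<open>
  A piecewise Bezier curve sampled at the regular parameters gives back its control polygon
  under the inverse block map. Each block of that map fixes the first and the last entry, since
  a Bezier curve interpolates its end control points; hence the map and its inverse preserve
  the junction and closure conditions defining the space of closed polygons. The sampled
  gradient satisfies these conditions because it depends only on the sampled point, and the
  samples themselves agree at the junctions.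
\<close>

lemma block_map_bezier:
  assumes "i < N" "j \<le> D"
  shows "block_map N D P i j = bezier D (P i) (real j / real D)"
  using assms by (simp add: block_map_def bezier_def)

lemma block_map_first: "i < N \<Longrightarrow> block_map N D P i 0 = P i 0"
  by (simp add: block_map_bezier bezier_0)

lemma block_map_last: "D \<ge> 1 \<Longrightarrow> i < N \<Longrightarrow> block_map N D P i D = P i D"
  by (simp add: block_map_bezier bezier_1)

lemma block_map_inv_left:
  assumes "D \<ge> 1" "P \<in> arrays N D"
  shows "block_map_inv N D (block_map N D P) = P"
  using bij_betw_inv_into_left[OF block_map_bij[OF assms(1)] assms(2)]
  by (simp add: block_map_inv_def)

text \<open>Writing \<open>Q\<close> as the image of some \<open>P\<close> avoids any formula for
  the inverse: \<open>P\<close> and \<open>Q\<close> share the entries at \<open>0\<close> and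
  \<open>D\<close> of each block, and only those enter the conditions of
  \<open>H N D\<close>.\<close>

lemma block_map_inv_in_H:
  assumes N: "N \<ge> 1" and D: "D \<ge> 1" and Q: "Q \<in> H N D"
  shows "block_map_inv N D Q \<in> H N D"
proof -
  have "Q \<in> arrays N D" using Q by (simp add: H_def K_def)
  then obtain P where P: "P \<in> arrays N D" and PQ: "Q = block_map N D P"
    using bij_betw_imp_surj_on[OF block_map_bij[OF D, of N]] by blast
  have "P i D = P (i + 1) 0" if "i + 1 < N" for i
  proof -
    have "Q i D = Q (i + 1) 0" using Q that by (simp add: H_def K_def)
    then show ?thesis using that D by (simp add: PQ block_map_first block_map_last)
  qed
  moreover have "P 0 0 = P (N - 1) D"
  proof -
    have "Q 0 0 = Q (N - 1) D" using Q by (simp add: H_def)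
    then show ?thesis using N D by (simp add: PQ block_map_first block_map_last)
  qed
  ultimately have "P \<in> H N D" using P by (simp add: H_def K_def)
  then show ?thesis using D P by (simp add: PQ block_map_inv_left)
qed

lemma sampling_Psi:
  assumes D: "D \<ge> 1" and P: "P \<in> K N D"
  shows "sampling N D (Psi N D P) = block_map N D P"
proof (intro ext)
  fix i j
  show "sampling N D (Psi N D P) i j = block_map N D P i j"
  proof (cases "i < N \<and> j \<le> D")
    case True
    let ?t = "real i / real N + real j / (real N * real D)"
    have pos: "real N > 0" "real D > 0" using True D by auto
    have "real N * ?t - real i = real j / real D" using pos by (simp add: field_simps)
    \<comment> \<open>The closed interval matters: for \<open>j = D\<close> the parameter is the
      junction \<open>(i + 1) / N\<close>, where \<open>Psi\<close> may select the next patch.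
      \<open>Psi_patch\<close> then relies on \<open>P\<close> being in
      \<open>K N D\<close>.\<close>
    moreover have "?t \<in> {real i / real N .. (real i + 1) / real N}"
      using pos True by (auto simp: field_simps)
    ultimately have "Psi N D P ?t = bezier D (P i) (real j / real D)"
      using Psi_patch[OF P] True by metis
    then show ?thesis using True by (simp add: sampling_def block_map_bezier)
  next
    case False
    then show ?thesis unfolding sampling_def block_map_def by (simp only: if_False)
  qed
qed

text \<open>The last node of patch \<open>i\<close> and the first node of patch \<open>i + 1\<close>
  are the same parameter, so the junction conditions hold for any map; closure compares parameters
  \<open>0\<close> and \<open>1\<close>.\<close>

lemma sampling_in_H:
  assumes N: "N \<ge> 1" and D: "D \<ge> 1" and closed: "\<gamma> 0 = \<gamma> 1"
  shows "sampling N D \<gamma> \<in> H N D"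
proof -
  have "real i / real N + real D / (real N * real D) = (real i + 1) / real N" for i
    using N D by (simp add: field_simps)
  then have last: "sampling N D \<gamma> i D = \<gamma> ((real i + 1) / real N)" if "i < N" for i
    using that by (simp add: sampling_def)
  have first: "sampling N D \<gamma> i 0 = \<gamma> (real i / real N)" if "i < N" for i
    using that by (simp add: sampling_def)
  have "sampling N D \<gamma> i D = sampling N D \<gamma> (i + 1) 0" if "i + 1 < N" for i
    using that by (simp add: first last add.commute)
  moreover have "sampling N D \<gamma> 0 0 = sampling N D \<gamma> (N - 1) D"
    using N closed by (simp add: first last of_nat_diff)
  moreover have "sampling N D \<gamma> \<in> arrays N D"
    by (auto simp: arrays_def sampling_def)
  ultimately show ?thesis by (simp add: H_def K_def)
qed

lemma gradient_sampling_in_H: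
  assumes "N \<ge> 1" "sampling N D \<alpha> \<in> H N D"
  shows "gradient_sampling N D gradF \<alpha> \<in> H N D"
  using assms by (auto simp: H_def K_def arrays_def gradient_sampling_def)

lemma piecewise_bezier_c_closed: "\<alpha> \<in> piecewise_bezier_c N D \<Longrightarrow> \<alpha> 0 = \<alpha> 1"
  by (simp add: piecewise_bezier_c_def)

lemma control_polygon:
  assumes N: "N \<ge> 1" and D: "D \<ge> 1" and \<alpha>: "\<alpha> \<in> piecewise_bezier_c N D"
  shows "block_map_inv N D (sampling N D \<alpha>) \<in> H N D"
    and "Psi_c N D (block_map_inv N D (sampling N D \<alpha>)) = \<alpha>"
proof -
  show *: "block_map_inv N D (sampling N D \<alpha>) \<in> H N D"
    using piecewise_bezier_c_closed[OF \<alpha>] N D by (intro block_map_inv_in_H sampling_in_H)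
  obtain P where P: "P \<in> K N D" "\<alpha> = Psi N D P"
    using \<alpha> by (auto simp: piecewise_bezier_c_def piecewise_bezier_def)
  \<comment> \<open>So far \<open>P\<close> is only known to lie in \<open>K N D\<close>. This
    identification puts it in \<open>H N D\<close>, where \<open>Psi_c\<close> agrees with
    \<open>Psi\<close>.\<close>
  then have "block_map_inv N D (sampling N D \<alpha>) = P"
    using D by (simp add: sampling_Psi block_map_inv_left K_def)
  with * show "Psi_c N D (block_map_inv N D (sampling N D \<alpha>)) = \<alpha>"
    using P by (simp add: Psi_c_def)
qed

lemma gradient_polygon_in_H:
  assumes "N \<ge> 1" "D \<ge> 1" "\<alpha> \<in> piecewise_bezier_c N D"
  shows "block_map_inv N D (gradient_sampling N D gradF \<alpha>) \<in> H N D"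
  using assms piecewise_bezier_c_closed
  by (intro block_map_inv_in_H gradient_sampling_in_H sampling_in_H) auto

theorem theorem1:
  fixes N D :: nat and gradF :: "curve \<Rightarrow> plane \<Rightarrow> plane"
  assumes "N \<ge> 1" and "D \<ge> 1" and "gradF \<in> shape_gradients"
  shows "vector_field_on (jordan_polygons N D) (tangent_H N D) (polygon_field N D gradF) \<and>
    vector_field_on (piecewise_bezier_c N D) (tangent_bezier_c N D) (curve_field N D gradF) \<and>
    (\<forall>P\<in>jordan_polygons N D.
       curve_field N D gradF (Psi_c N D P) = tangent_Psi_c N D P (polygon_field N D gradF P)) \<and>
    (\<forall>\<alpha>\<in>piecewise_bezier_c N D.
       let P = block_map_inv N D (sampling N D \<alpha>);
           X = block_map_inv N D (gradient_sampling N D gradF \<alpha>)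
       in P \<in> H N D \<and> Psi_c N D P = \<alpha> \<and> X \<in> tangent_H N D P \<and>
          curve_field N D gradF \<alpha> = tangent_Psi_c N D P X \<and>
          tangent_Psi_c N D P X \<in> tangent_bezier_c N D \<alpha>)"
  \<comment> \<open>The correspondence of the two fields follows by unfolding: the tangent map is
    \<open>Psi_c\<close> at every base point, so both sides are \<open>Psi_c\<close> of the same
    polygon.\<close>
  using control_polygon[OF assms(1,2)] gradient_polygon_in_H[OF assms(1,2)]
  by (auto simp: vector_field_on_def jordan_polygons_def tangent_H_def polygon_field_def
      tangent_bezier_c_def curve_field_def tangent_Psi_c_def Let_def)

end
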